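(* Let $\mathcal{F}$ be a collection of closed, convex subsets of the plane $\mathbb{R}^2$ such that (1) $\mathcal{F}$ has the $(4,3)$-property, and (2) $\mathcal{F}$ contains two members $A, B$ that are compact and disjoint. Then $\tau(\mathcal{F}) \leq 13$.
   Context: A collection of sets $\mathcal{F}$ has the $(p,q)$-property if among every $p$ distinct members of $\mathcal{F}$ there are $q$ that have a point in common. A transversal of $\mathcal{F}$ is a set $T$ with $T \cap F \neq \emptyset$ for all $F \in \mathcal{F}$. The transversal (piercing) number $\tau(\mathcal{F})$ is the minimum cardinality of a transversal of $\mathcal{F}$, with $\tau(\mathcal{F}) = \infty$ if no finite transversal exists.
   Formalization: The members of the collection are assumed nonempty; if the empty set were a member, no transversal would exist and the transversal number would be infinite (e.g. the collection consisting of the empty set, A and B). *)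

theory Defs
  imports "HOL-Analysis.Analysis" "HOL-Library.Extended_Nat"
begin

definition pq_property :: "nat \<Rightarrow> nat \<Rightarrow> 'a set set \<Rightarrow> bool" where
  "pq_property p q \<F> \<longleftrightarrow>
     (\<forall>\<G>\<subseteq>\<F>. finite \<G> \<and> card \<G> = p \<longrightarrow> (\<exists>\<H>\<subseteq>\<G>. card \<H> = q \<and> \<Inter>\<H> \<noteq> {}))"

definition is_transversal :: "'a set \<Rightarrow> 'a set set \<Rightarrow> bool" where
  "is_transversal T \<F> \<longleftrightarrow> (\<forall>F\<in>\<F>. T \<inter> F \<noteq> {})"

(* Inf on enat is the minimum of a nonempty set and \<infinity> for the empty set,
   so this is \<infinity> exactly when there is no finite transversal. *)
definition piercing_number :: "'a set set \<Rightarrow> enat" where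
  "piercing_number \<F> = (INF T\<in>{T. finite T \<and> is_transversal T \<F>}. enat (card T))"

end

theory Submission
  imports Defs
begin

text \<open>
  One point pierces the members disjoint from \<open>B\<close> (any three of them meet, as one sees by adding \<open>B\<close>), and
  one point pierces those disjoint from \<open>A\<close>. Every other member crosses a line \<open>s\<close> separating \<open>A\<close> from \<open>B\<close>
  in an interval, and any two members whose intervals are disjoint meet on exactly one side of \<open>s\<close>;
  colour such pairs by this side. By the (4,3)-property there is no alternating 4-cycle, and this forces a
  partition of the crossing members into two classes, each containing only one of the colours.
  Adding \<open>A\<close> or \<open>B\<close> to three members of one class with disjoint intervals shows that they meet.
  Hence, by colourful Helly, among three subfamilies of one class that occupy disjoint parts of \<open>s\<close>
  one is pierced by a single point, and a greedy sweep along \<open>s\<close> pierces the class by five points.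
  This gives 12 points for finite families. In general, intersect all members with the convex hull of
  \<open>A \<union> B\<close>, which preserves the (4,3)-property by Helly, and use compactness.
\<close>

section \<open>Two-coloured families of intervals\<close>

text \<open>Only pairs with disjoint intervals count as coloured edges; elsewhere \<open>col\<close>
  is any symmetric relation. The names in \<open>no_alternating\<close> may coincide, but
  \<open>a = d\<close> or \<open>b = e\<close> would contradict the symmetry of
  \<open>col\<close>.\<close>

locale bicoloured_intervals =
  fixes V :: "'a set" and lo hi :: "'a \<Rightarrow> real" and col :: "'a \<Rightarrow> 'a \<Rightarrow> bool"
  assumes lo_le_hi: "x \<in> V \<Longrightarrow> lo x \<le> hi x"
    and col_sym: "col x y = col y x"
    and no_alternating:
      "\<lbrakk>a \<in> V; b \<in> V; d \<in> V; e \<in> V;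
        hi a < lo b \<or> hi b < lo a; hi b < lo d \<or> hi d < lo b;
        hi d < lo e \<or> hi e < lo d; hi e < lo a \<or> hi a < lo e;
        col a b = c; col b d = (\<not> c); col d e = c; col e a = (\<not> c)\<rbrakk> \<Longrightarrow> False"
begin

definition edge :: "bool \<Rightarrow> 'a \<Rightarrow> 'a \<Rightarrow> bool" where
  "edge c x y \<longleftrightarrow> x \<in> V \<and> y \<in> V \<and> (hi x < lo y \<or> hi y < lo x) \<and> col x y = c"

definition touch :: "'a \<Rightarrow> 'a \<Rightarrow> bool" where
  "touch x y \<longleftrightarrow> x \<in> V \<and> y \<in> V \<and> lo x \<le> hi y \<and> lo y \<le> hi x"

lemma edge_sym: "edge c x y \<longleftrightarrow> edge c y x"
  using col_sym by (auto simp: edge_def)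

lemma touch_sym: "touch x y \<longleftrightarrow> touch y x"
  by (auto simp: touch_def)

lemma edge_not_touch: "edge c x y \<Longrightarrow> \<not> touch x y"
  by (auto simp: edge_def touch_def)

lemma trichotomy: "x \<in> V \<Longrightarrow> y \<in> V \<Longrightarrow> touch x y \<or> edge c x y \<or> edge (\<not> c) x y"
  by (auto simp: edge_def touch_def)

lemma edge_in: "edge c x y \<Longrightarrow> x \<in> V \<and> y \<in> V"
  by (auto simp: edge_def)

lemma no_alt: "\<lbrakk>edge c a b; edge (\<not> c) b d; edge c d e; edge (\<not> c) e a\<rbrakk> \<Longrightarrow> False"
  using no_alternating[of a b d e c] by (auto simp: edge_def)

section \<open>Chordality of the touching graph\<close>

lemma touch_at_min: "\<lbrakk>touch a x; touch b x; hi x \<le> hi a; hi x \<le> hi b\<rbrakk> \<Longrightarrow> touch a b"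
  by (auto simp: touch_def)

text \<open>On a cycle of touching intervals, some vertex ends no later than its two neighbours.
  Both neighbours then contain its right endpoint and touch, against the chord between them. The
  same argument gives \<open>no_C5\<close> and \<open>no_C6\<close>.\<close>

lemma no_C4:
  assumes "touch a b" "touch b d" "touch d e" "touch e a" "edge c a d" "edge c' b e"
  shows False
proof -
  consider "hi a \<le> hi b \<and> hi a \<le> hi e" | "hi b \<le> hi a \<and> hi b \<le> hi d"
    | "hi d \<le> hi b \<and> hi d \<le> hi e" | "hi e \<le> hi a \<and> hi e \<le> hi d"
    by linarith
  then show False
    using assms edge_not_touch touch_at_min touch_sym by cases metis+
qed

lemma no_C5:
  assumes "touch a b" "touch b d" "touch d e" "touch e f" "touch f a"
    "edge c1 a d" "edge c2 b e" "edge c3 d f" "edge c4 e a" "edge c5 f b"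
  shows False
proof -
  consider "hi a \<le> hi b \<and> hi a \<le> hi f" | "hi b \<le> hi a \<and> hi b \<le> hi d"
    | "hi d \<le> hi b \<and> hi d \<le> hi e" | "hi e \<le> hi d \<and> hi e \<le> hi f" | "hi f \<le> hi e \<and> hi f \<le> hi a"
    by linarith
  then show False
    using assms edge_not_touch touch_at_min touch_sym by cases metis+
qed

text \<open>The argument only looks at chords two steps apart, so the three long diagonals may be of
  any kind.\<close>

lemma no_C6:
  assumes "touch a b" "touch b d" "touch d e" "touch e f" "touch f g" "touch g a"
    "edge c1 a d" "edge c2 b e" "edge c3 d f" "edge c4 e g" "edge c5 f a" "edge c6 g b"
  shows False
proof -
  consider "hi a \<le> hi b \<and> hi a \<le> hi g" | "hi b \<le> hi a \<and> hi b \<le> hi d"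
    | "hi d \<le> hi b \<and> hi d \<le> hi e" | "hi e \<le> hi d \<and> hi e \<le> hi f"
    | "hi f \<le> hi e \<and> hi f \<le> hi g" | "hi g \<le> hi f \<and> hi g \<le> hi a"
    by linarith
  then show False
    using assms edge_not_touch touch_at_min touch_sym by cases metis+
qed

section \<open>Vertices whose class is forced\<close>

text \<open>In the partition sought, \<open>x\<close> must lie in class \<open>c\<close>: otherwise
  its \<open>c\<close>-edges would push both \<open>p\<close> and \<open>q\<close> into class
  \<open>c\<close>, which cannot contain the edge \<open>p q\<close> of the other colour.\<close>

definition source :: "bool \<Rightarrow> 'a \<Rightarrow> bool" where
  "source c x \<longleftrightarrow> (\<exists>p q. edge c x p \<and> edge c x q \<and> edge (\<not> c) p q)"

lemma path3: "\<lbrakk>edge c a b; edge (\<not> c) b d; edge c d e\<rbrakk> \<Longrightarrow> touch a e \<or> edge c a e"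
  using no_alt trichotomy edge_sym edge_in by metis

lemma source_intro: "\<lbrakk>edge c x p; edge c x q; edge (\<not> c) p q\<rbrakk> \<Longrightarrow> source c x"
  by (auto simp: source_def)

text \<open>An edge of either colour between the bases \<open>p q\<close> and \<open>p' q'\<close>
  completes an alternating 4-cycle through \<open>x\<close>. Hence \<open>p p' q q'\<close> is a
  touching 4-cycle with edges as diagonals.\<close>

lemma source_vertex: "source c x \<Longrightarrow> source (\<not> c) x \<Longrightarrow> False"
proof -
  assume "source c x" "source (\<not> c) x"
  then obtain p q p' q' where *: "edge c x p" "edge c x q" "edge (\<not> c) p q" "edge (\<not> c) x p'" "edge (\<not> c) x q'" "edge c p' q'"
    by (auto simp: source_def)
  have "touch p p'" "touch p' q" "touch q q'" "touch q' p"
    using * no_alt trichotomy edge_sym edge_in touch_sym by metis+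
  then show False using no_C4 * by metis
qed

lemma source_edge:
  assumes "source c u" "source c v" "edge (\<not> c) u v"
  shows False
proof -
  obtain p q where u: "edge c u p" "edge c u q" "edge (\<not> c) p q"
    using assms(1) by (auto simp: source_def)
  obtain p' q' where v: "edge c v p'" "edge c v q'" "edge (\<not> c) p' q'"
    using assms(2) by (auto simp: source_def)
  \<comment> \<open>Colour \<open>c\<close> would give the alternating cycle \<open>v p q u\<close>;
    the other colour would make \<open>v\<close> a source of both colours.\<close>
  have touch1: "touch v p" if "edge c u p" "edge c u q" "edge (\<not> c) p q" "edge (\<not> c) u v" "source c v" for u v p q
  proof -
    have "\<not> edge c v p"
      using that no_alt edge_sym by metis
    moreover have "\<not> edge (\<not> c) v p"
      using that source_intro[of "\<not> c" v u p] source_vertex edge_sym by auto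
    ultimately show ?thesis
      using trichotomy that edge_in by metis
  qed
  have t: "touch v p" "touch v q" "touch u p'" "touch u q'"
    using touch1 u v assms edge_sym by metis+
  have cross: "touch x y \<or> edge c x y" if "edge c u x" "edge c v y" for x y
    using path3 that assms(3) edge_sym by metis
  have 1: "\<not> (touch p p' \<and> touch q q')"
  proof
    assume "touch p p' \<and> touch q q'"
    then show False
      using no_C6[of u p' p v q q'] t u v touch_sym edge_sym by metis
  qed
  have 2: "\<not> (touch p q' \<and> touch q p')"
  proof
    assume "touch p q' \<and> touch q p'"
    then show False
      using no_C6[of u q' p v q p'] t u v touch_sym edge_sym by metis
  qed
  have 3: "\<not> (touch q p' \<and> touch q q')" "\<not> (touch p p' \<and> touch p q')"
    using no_C4[of _ p' u q'] t u v touch_sym edge_sym by metis+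
  have 4: "\<not> (touch p q' \<and> touch q q')" "\<not> (touch p p' \<and> touch q p')"
    using no_C4[of v p _ q] t u v touch_sym edge_sym by metis+
  have 5: "\<not> (edge c q p' \<and> edge c p q')" "\<not> (edge c p p' \<and> edge c q q')"
    using no_alt u v edge_sym by metis+
  \<comment> \<open>In the 2 by 2 table of pairs between the bases, facts 3 and 4 exclude two
    touching pairs in a row or column, 1 and 2 exclude a touching diagonal. So at most one pair
    touches and some diagonal has colour \<open>c\<close> throughout, against 5.\<close>
  show False
    using 1 2 3 4 5 cross u v by blast
qed

text \<open>The two ends make contradictory demands on the class of \<open>w1\<close>.\<close>

lemma source_path2:
  assumes "source c w0" "edge (\<not> c) w0 w1" "edge c w1 w2" "source (\<not> c) w2"
  shows False
proof -
  obtain p q where p: "edge c w0 p" "edge c w0 q" "edge (\<not> c) p q"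
    using assms(1) by (auto simp: source_def)
  obtain r s where r: "edge (\<not> c) w2 r" "edge (\<not> c) w2 s" "edge c r s"
    using assms(4) by (auto simp: source_def)
  have t: "touch x w1" if "edge c w0 x" "edge c w0 y" "edge (\<not> c) x y" for x y
  proof -
    have "touch x w1 \<or> edge (\<not> c) x w1"
      using path3[of "\<not> c" x y w0 w1] that assms edge_sym by auto
    moreover have "\<not> edge (\<not> c) x w1"
      using source_intro[of "\<not> c" w1 x w0] source_edge[of "\<not> c" w1 w2] that assms edge_sym by auto
    ultimately show ?thesis by blast
  qed
  have t': "touch x w1" if "edge (\<not> c) w2 x" "edge (\<not> c) w2 y" "edge c x y" for x y
  proof -
    have "touch x w1 \<or> edge c x w1"
      using path3[of c x y w2 w1] that assms edge_sym by auto
    moreover have "\<not> edge c x w1"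
      using source_intro[of c w1 x w2] source_edge[of c w0 w1] that assms edge_sym by auto
    ultimately show ?thesis by blast
  qed
  have t1: "touch p w1" "touch q w1" "touch r w1" "touch s w1"
    using t t' p r edge_sym by metis+
  \<comment> \<open>An edge here would close a triangle with \<open>w1\<close> and make
    \<open>w0\<close> or \<open>w2\<close> a source of both colours.\<close>
  have t2: "touch w0 w2"
  proof -
    have "\<not> edge c w0 w2"
      using source_intro[of c w2 w0 w1] source_vertex assms edge_sym by metis
    moreover have "\<not> edge (\<not> c) w0 w2"
      using source_intro[of "\<not> c" w0 w1 w2] source_vertex assms by auto
    ultimately show ?thesis
      using trichotomy assms edge_in by metis
  qed
  have "touch p w2 \<or> touch q w2"
  proof (rule ccontr)
    assume "\<not> ?thesis"
    then have "edge c p w2" "edge c q w2"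
      using path3 p assms edge_sym by metis+
    then show False
      using source_intro[of c w2 p q] p source_vertex assms edge_sym by metis
  qed
  then obtain a where a: "touch a w1" "touch a w2" "edge c w0 a"
    using p t1 by blast
  have "touch r w0 \<or> touch s w0"
  proof (rule ccontr)
    assume "\<not> ?thesis"
    then have "edge (\<not> c) r w0" "edge (\<not> c) s w0"
      using path3[of "\<not> c" _ w2 w1 w0] r assms edge_sym by auto
    then show False
      using source_intro[of "\<not> c" w0 r s] r source_vertex assms edge_sym by auto
  qed
  then obtain b where b: "touch b w1" "touch b w0" "edge (\<not> c) w2 b"
    using r t1 by blast
  \<comment> \<open>The touching cycle is \<open>a w2 w0 b\<close>, or \<open>w1 a w2 w0 b\<close>
    if \<open>a b\<close> is itself an edge.\<close>
  show False
  proof (cases "touch a b")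
    case True
    then show False
      using no_C4[of a w2 w0 b] a b t2 touch_sym edge_sym by metis
  next
    case False
    then obtain d where "edge d a b"
      using trichotomy a b edge_in by metis
    then show False
      using no_C5[of w1 a w2 w0 b] a b t2 assms touch_sym edge_sym by metis
  qed
qed

text \<open>In a partition without \<open>False\<close>-edges in class \<open>True\<close> and without \<open>True\<close>-edges in class \<open>False\<close>,
  a source of colour \<open>c\<close> must lie in class \<open>c\<close>, and the end of an alternating path starting at it is
  forced as well. By \<open>source_path3\<close> below, paths of length at most two already force everything.\<close>

definition forced :: "bool \<Rightarrow> 'a \<Rightarrow> bool" where
  "forced c x \<longleftrightarrow> source c x \<or> (\<exists>s. source (\<not> c) s \<and> edge c s x) \<or> (\<exists>s t. source c s \<and> edge (\<not> c) s t \<and> edge c t x)"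

text \<open>If \<open>w3\<close> were not forced, then each edge that would create a suitable source
  is excluded, and enough pairs touch to give the chordless 5-cycle
  \<open>w1 b w2 w0 w3\<close>.\<close>

lemma source_path3:
  assumes "source c w0" "edge (\<not> c) w0 w1" "edge c w1 w2" "edge (\<not> c) w2 w3"
  shows "forced (\<not> c) w3"
proof (rule ccontr)
  assume neg: "\<not> ?thesis"
  then have n: "\<not> source (\<not> c) w3" "\<And>s. source c s \<Longrightarrow> \<not> edge (\<not> c) s w3"
    "\<And>s t. source (\<not> c) s \<Longrightarrow> edge c s t \<Longrightarrow> \<not> edge (\<not> c) t w3"
    by (auto simp: forced_def)
  obtain p q where p: "edge c w0 p" "edge c w0 q" "edge (\<not> c) p q"
    using assms(1) by (auto simp: source_def)
  have t03: "touch w0 w3"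
    using path3[of "\<not> c" w0 w1 w2 w3] assms n by auto
  have t: "touch x w1" if "edge c w0 x" "edge c w0 y" "edge (\<not> c) x y" for x y
  proof -
    have "touch x w1 \<or> edge (\<not> c) x w1"
      using path3[of "\<not> c" x y w0 w1] that assms edge_sym by auto
    moreover have "\<not> edge (\<not> c) x w1"
      using source_intro[of "\<not> c" w1 x w0] n(3)[of w1 w2] that assms edge_sym by auto
    ultimately show ?thesis by blast
  qed
  have t1: "touch p w1" "touch q w1"
    using t p edge_sym by metis+
  have ex: "touch x w2 \<or> edge c x w2" if "edge c w0 x" for x
    using path3 that assms edge_sym by metis
  \<comment> \<open>Exactly one of \<open>p\<close>, \<open>q\<close> touches \<open>w2\<close>: two
    touches give the chordless 4-cycle \<open>p w1 q w2\<close>, two edges make \<open>w2\<close> a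
    source that forces \<open>w3\<close>.\<close>
  have "\<not> (touch p w2 \<and> touch q w2)"
    using no_C4[of p w1 q w2] t1 p assms touch_sym edge_sym by metis
  moreover have "\<not> (edge c p w2 \<and> edge c q w2)"
    using source_intro[of c w2 p q] n(2) p assms edge_sym by metis
  ultimately obtain a b where a: "edge c w0 a" "edge c w0 b" "edge (\<not> c) a b" "edge c a w2" "touch b w2" "touch b w1"
    using ex p t1 edge_sym by metis
  have t02: "touch w0 w2"
  proof -
    have "\<not> edge c w0 w2"
      using source_intro[of c w2 w0 w1] n(2) assms edge_sym by metis
    moreover have "\<not> edge (\<not> c) w0 w2"
      using source_intro[of "\<not> c" w0 w1 w2] source_vertex assms by auto
    ultimately show ?thesis
      using trichotomy assms edge_in by metis
  qed
  have b3: "edge (\<not> c) b w3"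
  proof -
    have "touch b w3 \<or> edge (\<not> c) b w3"
      using path3[of "\<not> c" b a w2 w3] a assms edge_sym by auto
    moreover have "\<not> touch b w3"
      using no_C4[of w0 w2 b w3] a t02 t03 assms touch_sym edge_sym by metis
    ultimately show ?thesis by blast
  qed
  have "\<not> edge c w1 w3"
    using source_intro[of c w1 w2 w3] source_edge[of c w0 w1] assms by auto
  moreover have "\<not> edge (\<not> c) w1 w3"
    using source_intro[of "\<not> c" w3 w1 w2] n(1) assms edge_sym by auto
  ultimately have "touch w1 w3"
    using trichotomy assms edge_in by metis
  then show False
    using no_C5[of w1 b w2 w0 w3] a b3 t02 t03 assms touch_sym edge_sym by metis
qed

lemma forced_closed: "forced c x \<Longrightarrow> edge (\<not> c) x y \<Longrightarrow> forced (\<not> c) y"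
proof -
  assume forced: "forced c x" and e: "edge (\<not> c) x y"
  consider "source c x" | s where "source (\<not> c) s" "edge c s x" | s t where "source c s" "edge (\<not> c) s t" "edge c t x"
    using forced by (auto simp: forced_def)
  then show ?thesis
  proof cases
    case 1
    then show ?thesis using e by (auto simp: forced_def)
  next
    case 2
    then show ?thesis using e by (auto simp: forced_def)
  next
    case 3
    then show ?thesis using e source_path3 by blast
  qed
qed

text \<open>For a source, the three ways of being forced the other way are excluded by
  \<open>source_vertex\<close>, \<open>source_edge\<close> and \<open>source_path2\<close>. For any
  other vertex, \<open>forced_closed\<close> carries the conflict back along its forcing path to the
  source.\<close>

lemma forced_consistent:
  assumes "forced c x" "forced (\<not> c) x"
  shows False
proof -
  have *: False if "source c x" "forced (\<not> c) x" for c x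
    using that source_vertex[of c] source_edge[of c] source_path2[of "\<not> c"] by (auto simp: forced_def)
  consider "source c x" | s where "source (\<not> c) s" "edge c s x" | s t where "source c s" "edge (\<not> c) s t" "edge c t x"
    using assms(1) by (auto simp: forced_def)
  then show False
  proof cases
    case 1
    then show False using * assms by blast
  next
    case 2
    then show False
      using *[of "\<not> c" s] forced_closed[of "\<not> c" x s] assms edge_sym by auto
  next
    case 3
    then show False
      using *[of c s] forced_closed[of "\<not> c" x t] forced_closed[of c t s] assms edge_sym by auto
  qed
qed

section \<open>Closed classes and the partition\<close>

text \<open>Each alternative replaces three edges of an alternating walk by one. Without sources,
  the ends of a two-coloured path of length two touch; if both shortcuts failed, there would be a
  chordless cycle on \<open>v0\<close>, \<open>v4\<close>, \<open>v1\<close>, \<open>v3\<close> or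
  on all five vertices.\<close>

lemma no_source_path4:
  assumes "\<And>c x. \<not> source c x"
    and "edge c v0 v1" "edge (\<not> c) v1 v2" "edge c v2 v3" "edge (\<not> c) v3 v4"
  shows "edge c v0 v3 \<or> edge (\<not> c) v1 v4"
proof (rule ccontr)
  assume "\<not> ?thesis"
  then have t: "touch v0 v3" "touch v1 v4"
    using path3[of c v0 v1 v2 v3] path3[of "\<not> c" v1 v2 v3 v4] assms by auto
  have mixed: "touch x z" if "edge d x y" "edge (\<not> d) y z" for d x y z
  proof -
    have "\<not> edge d x z"
      using that source_intro[of d x y z] assms(1) by blast
    moreover have "\<not> edge (\<not> d) x z"
      using that source_intro[of "\<not> d" z x y] assms(1) edge_sym by auto
    ultimately show ?thesis
      using that trichotomy edge_in by metis
  qed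
  have u: "touch v0 v2" "touch v1 v3" "touch v2 v4"
    using mixed[of c v0 v1 v2] mixed[of "\<not> c" v1 v2 v3] mixed[of c v2 v3 v4] assms by auto
  show False
  proof (cases "touch v0 v4")
    case True
    then show False
      using no_C4[of v0 v4 v1 v3] t u assms touch_sym edge_sym by metis
  next
    case False
    then obtain d where "edge d v0 v4"
      using trichotomy assms edge_in by metis
    then show False
      using no_C5[of v0 v2 v4 v1 v3] t u assms touch_sym edge_sym by metis
  qed
qed

text \<open>Since \<open>P\<close> and \<open>N\<close> are closed under forcing, the remaining
  vertices can be partitioned independently. If sources exist, the forced vertices serve; otherwise
  one vertex is placed at will and its consequences are collected.\<close>

lemma forced_classes:
  assumes "V \<noteq> {}"
  obtains P N where "P \<subseteq> V" "N \<subseteq> V" "P \<inter> N = {}" "P \<union> N \<noteq> {}"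
    "\<And>x y. x \<in> P \<Longrightarrow> edge False x y \<Longrightarrow> y \<in> N" "\<And>x y. x \<in> N \<Longrightarrow> edge True x y \<Longrightarrow> y \<in> P"
proof (cases "\<exists>c x. source c x")
  case True
  then obtain c x where "source c x"
    by blast
  then have "forced c x"
    by (simp add: forced_def)
  then have "{x. forced True x} \<union> {x. forced False x} \<noteq> {}"
    by (cases c) auto
  moreover have "forced c x \<Longrightarrow> x \<in> V" for c x
    using edge_in unfolding forced_def source_def by metis
  then have "{x. forced True x} \<subseteq> V" "{x. forced False x} \<subseteq> V"
    by auto
  moreover have "{x. forced True x} \<inter> {x. forced False x} = {}"
    using forced_consistent[of True] by auto
  moreover have "y \<in> {x. forced False x}" if "x \<in> {x. forced True x}" "edge False x y" for x y
    using forced_closed[of True x y] that by simp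
  moreover have "y \<in> {x. forced True x}" if "x \<in> {x. forced False x}" "edge True x y" for x y
    using forced_closed[of False x y] that by simp
  ultimately show ?thesis
    by (intro that[of "{x. forced True x}" "{x. forced False x}"])
next
  case False
  then have no_source: "\<And>c x. \<not> source c x"
    by blast
  have mixed: "\<not> edge d x z" if "edge c x y" "edge (\<not> c) y z" for c d x y z
  proof -
    have "\<not> edge c x z"
      using that source_intro[of c x y z] no_source by blast
    moreover have "\<not> edge (\<not> c) x z"
      using that source_intro[of "\<not> c" z x y] no_source edge_sym by auto
    ultimately show ?thesis
      by (cases "d = c") auto
  qed
  obtain v where v: "v \<in> V"
    using assms by blast
  \<comment> \<open>With \<open>v\<close> put into \<open>P\<close>, alternating walks beginning
    with a \<open>False\<close>-edge determine the rest: even length leads to \<open>P\<close>, odd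
    length to \<open>N\<close>. By \<open>no_source_path4\<close> at most three edges are
    needed.\<close>
  define P where "P = {v} \<union> {x. \<exists>a. edge False v a \<and> edge True a x}"
  define N where "N = {y. edge False v y} \<union> {y. \<exists>a b. edge False v a \<and> edge True a b \<and> edge False b y}"
  have "y \<in> N" if "x \<in> P" "edge False x y" for x y
    using that unfolding P_def N_def by blast
  moreover have "x \<in> P" if "y \<in> N" "edge True y x" for x y
  proof -
    consider "edge False v y" | a b where "edge False v a" "edge True a b" "edge False b y"
      using \<open>y \<in> N\<close> by (auto simp: N_def)
    then show ?thesis
    proof cases
      case 1
      then show ?thesis using that(2) unfolding P_def by blast
    next
      case 2
      then have "edge False v y \<or> edge True a x"
        using no_source_path4[of False v a b y x] no_source that(2) by simp
      then show ?thesis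
        using 2 that(2) unfolding P_def by blast
    qed
  qed
  moreover have "P \<inter> N = {}"
  proof -
    have 1: "\<not> edge False v v"
      using lo_le_hi[OF v] by (simp add: edge_def)
    have 2: False if "edge False v a" "edge True a b" "edge False b v" for a b
      using that mixed[of False v a b False] edge_sym by auto
    have 3: False if "edge False v a" "edge True a x" "edge False v x" for a x
      using that mixed[of False v a x False] by auto
    \<comment> \<open>A vertex reached in both two and three steps yields the walk
      \<open>v a x b a'\<close>; either of its shortcuts is excluded by 3.\<close>
    have 4: False if "edge False v a" "edge True a x" "edge False v a'" "edge True a' b" "edge False b x" for a x a' b
    proof -
      have "edge False v b \<or> edge True a a'"
        using no_source_path4[of False v a x b a'] no_source that edge_sym by auto
      then show False
        using that 3[of a' b] 3[of a a'] by auto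
    qed
    show ?thesis
    proof (rule equals0I)
      fix x assume x: "x \<in> P \<inter> N"
      consider "x = v" | a where "edge False v a" "edge True a x"
        using x by (auto simp: P_def)
      then show False
      proof cases
        case v: 1
        then show False
          using x 1 2 by (auto simp: N_def)
      next
        case a: 2
        consider "edge False v x" | a' b where "edge False v a'" "edge True a' b" "edge False b x"
          using x by (auto simp: N_def)
        then show False
          using a 3 4 by cases blast+
      qed
    qed
  qed
  moreover have "P \<subseteq> V" "N \<subseteq> V" "P \<union> N \<noteq> {}"
    using v edge_in by (auto simp: P_def N_def)
  ultimately show ?thesis
    by (intro that[of P N])
qed

end

lemma bicoloured_intervals_subset:
  assumes "bicoloured_intervals V lo hi col" and "W \<subseteq> V"
  shows "bicoloured_intervals W lo hi col"
proof -
  interpret bicoloured_intervals V lo hi col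
    by fact
  show ?thesis
  proof
    show "lo x \<le> hi x" if "x \<in> W" for x
      using that assms(2) lo_le_hi by blast
    show "col x y = col y x" for x y
      by (rule col_sym)
    fix a b d e c
    assume *: "a \<in> W" "b \<in> W" "d \<in> W" "e \<in> W"
      "hi a < lo b \<or> hi b < lo a" "hi b < lo d \<or> hi d < lo b"
      "hi d < lo e \<or> hi e < lo d" "hi e < lo a \<or> hi a < lo e"
      "col a b = c" "col b d = (\<not> c)" "col d e = c" "col e a = (\<not> c)"
    show False
      by (rule no_alternating[of a b d e c]) (use * assms(2) in blast)+
  qed
qed

text \<open>Induction, removing \<open>P\<close> and \<open>N\<close>: edges from \<open>P\<close>
  to anything outside \<open>N\<close> are \<open>True\<close>, those from \<open>N\<close> to
  anything outside \<open>P\<close> are \<open>False\<close>, so the classes of the rest can be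
  added.\<close>

theorem bicoloured_intervals_split:
  assumes "finite V" and "bicoloured_intervals V lo hi col"
  shows "\<exists>P\<subseteq>V. (\<forall>x\<in>P. \<forall>y\<in>P. hi x < lo y \<longrightarrow> col x y)
    \<and> (\<forall>x\<in>V - P. \<forall>y\<in>V - P. hi x < lo y \<longrightarrow> \<not> col x y)"
  using assms
proof (induction V rule: finite_psubset_induct)
  case (psubset V)
  show ?case
  proof (cases "V = {}")
    case False
    interpret bicoloured_intervals V lo hi col
      by fact
    obtain P N where PN: "P \<subseteq> V" "N \<subseteq> V" "P \<inter> N = {}" "P \<union> N \<noteq> {}"
      and P: "\<And>x y. x \<in> P \<Longrightarrow> edge False x y \<Longrightarrow> y \<in> N"
      and N: "\<And>x y. x \<in> N \<Longrightarrow> edge True x y \<Longrightarrow> y \<in> P"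
      using forced_classes False by blast
    have "V - (P \<union> N) \<subset> V"
      using PN by blast
    then obtain P' where P': "P' \<subseteq> V - (P \<union> N)"
      "\<forall>x\<in>P'. \<forall>y\<in>P'. hi x < lo y \<longrightarrow> col x y"
      "\<forall>x\<in>V - (P \<union> N) - P'. \<forall>y\<in>V - (P \<union> N) - P'. hi x < lo y \<longrightarrow> \<not> col x y"
      using psubset.IH bicoloured_intervals_subset[OF psubset.prems] by (metis psubset_imp_subset)
    have P2: "col x y" if "x \<in> P" "y \<in> V" "y \<notin> N" "hi x < lo y \<or> hi y < lo x" for x y
      using P[of x y] that PN by (auto simp: edge_def)
    have N2: "\<not> col x y" if "x \<in> N" "y \<in> V" "y \<notin> P" "hi x < lo y \<or> hi y < lo x" for x y
      using N[of x y] that PN by (auto simp: edge_def)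
    have "\<forall>x\<in>P \<union> P'. \<forall>y\<in>P \<union> P'. hi x < lo y \<longrightarrow> col x y"
      using P'(1,2) P2 PN col_sym by blast
    moreover have "\<forall>x\<in>V - (P \<union> P'). \<forall>y\<in>V - (P \<union> P'). hi x < lo y \<longrightarrow> \<not> col x y"
      using P'(1,3) N2 PN col_sym by blast
    moreover have "P \<union> P' \<subseteq> V"
      using P' PN by blast
    ultimately show ?thesis
      by blast
  qed simp
qed

section \<open>Colourful Helly and piercing along a line\<close>

text \<open>\<open>Helly\<close> speaks of a set of sets, so coinciding sets are treated apart; then
  some triple intersection is already the whole one.\<close>

lemma helly_plane_four:
  fixes A B C D :: "'a::euclidean_space set"
  assumes dim: "DIM('a) = 2"
    and "convex A" "convex B" "convex C" "convex D"
    and tri: "A \<inter> B \<inter> C \<noteq> {}" "A \<inter> B \<inter> D \<noteq> {}" "A \<inter> C \<inter> D \<noteq> {}" "B \<inter> C \<inter> D \<noteq> {}"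
  shows "A \<inter> B \<inter> C \<inter> D \<noteq> {}"
proof (cases "card {A, B, C, D} = 4")
  case True
  have "\<Inter>{A, B, C, D} \<noteq> {}"
  proof (rule Helly)
    show "DIM('a) + 1 \<le> card {A, B, C, D}"
      using True dim by simp
    show "\<forall>s\<in>{A, B, C, D}. convex s"
      using assms by simp
    show "\<Inter>t \<noteq> {}" if t: "t \<subseteq> {A, B, C, D}" "card t = DIM('a) + 1" for t
    proof -
      have "\<not> {A, B, C, D} \<subseteq> t"
        using t True dim by force
      then have "t \<subseteq> {B, C, D} \<or> t \<subseteq> {A, C, D} \<or> t \<subseteq> {A, B, D} \<or> t \<subseteq> {A, B, C}"
        using t(1) unfolding subset_iff insert_iff empty_iff by metis
      moreover have "\<Inter>t \<noteq> {}" if "t \<subseteq> {X, Y, Z}" "X \<inter> Y \<inter> Z \<noteq> {}" for X Y Z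
        using Inter_anti_mono[OF that(1)] that(2) by (auto simp: Int_assoc)
      ultimately show ?thesis
        using tri by metis
    qed
  qed
  then show ?thesis by (simp add: Int_assoc)
next
  case False
  have "A = B \<or> A = C \<or> A = D \<or> B = C \<or> B = D \<or> C = D"
  proof (rule ccontr)
    assume "\<not> ?thesis"
    then have "card {A, B, C, D} = 4" by simp
    then show False using False by simp
  qed
  then consider "A = B" | "A = C" | "A = D" | "B = C" | "B = D" | "C = D"
    by fastforce
  then show ?thesis
  proof cases
    case 1 then show ?thesis using tri(3) by blast
  next
    case 2 then show ?thesis using tri(2) by blast
  next
    case 3 then show ?thesis using tri(1) by blast
  next
    case 4 then show ?thesis using tri(2) by blast
  next
    case 5 then show ?thesis using tri(1) by blast
  next
    case 6 then show ?thesis using tri(1) by blast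
  qed
qed

text \<open>The ball around the origin that just touches \<open>C \<inter> D\<close> plays the role of a fourth convex set.\<close>

lemma closest_point_mem_third:
  fixes C D Z :: "'a::euclidean_space set"
  assumes dim: "DIM('a) = 2"
    and C: "closed C" "convex C" and D: "closed D" "convex D" and Z: "closed Z" "convex Z"
    and CDZ: "C \<inter> D \<inter> Z \<noteq> {}"
    and CZ: "norm (closest_point (C \<inter> Z) 0) \<le> norm (closest_point (C \<inter> D) 0)"
    and DZ: "norm (closest_point (D \<inter> Z) 0) \<le> norm (closest_point (C \<inter> D) 0)"
  shows "closest_point (C \<inter> D) 0 \<in> Z"
proof -
  define w where "w = closest_point (C \<inter> D) 0"
  have mem: "closest_point (X \<inter> Y) 0 \<in> X \<inter> Y" if "closed X" "closed Y" "X \<inter> Y \<noteq> {}" for X Y :: "'a set"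
    using closest_point_in_set[of "X \<inter> Y" 0] that by (simp add: closed_Int)
  have "C \<inter> D \<inter> Z \<inter> cball 0 (norm w) \<noteq> {}"
  proof (rule helly_plane_four)
    show "C \<inter> D \<inter> cball 0 (norm w) \<noteq> {}"
      using mem[of C D] C D CDZ unfolding w_def by force
    show "C \<inter> Z \<inter> cball 0 (norm w) \<noteq> {}"
      using mem[of C Z] C Z CZ CDZ by (force simp: w_def)
    show "D \<inter> Z \<inter> cball 0 (norm w) \<noteq> {}"
      using mem[of D Z] D Z DZ CDZ by (force simp: w_def)
  qed (use assms in auto)
  then obtain p where p: "p \<in> C" "p \<in> D" "p \<in> Z" "norm p \<le> norm w"
    by auto
  have "p = w"
    unfolding w_def
  proof (rule closest_point_unique)
    show "\<forall>z\<in>C \<inter> D. dist 0 p \<le> dist 0 z"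
      using closest_point_le[of "C \<inter> D" _ 0] C D p(4) by (fastforce simp: w_def closed_Int)
  qed (use C D p in \<open>auto intro: convex_Int closed_Int\<close>)
  then show ?thesis
    using p w_def by simp
qed

text \<open>Among all pairs from two different families, choose one whose intersection is farthest
  from the origin. Its point nearest to the origin lies in every member of the third family.\<close>

lemma colourful_helly_plane:
  fixes H1 H2 H3 :: "'a::euclidean_space set set"
  assumes dim: "DIM('a) = 2"
    and fin: "finite H1" "finite H2" "finite H3" and ne: "H1 \<noteq> {}" "H2 \<noteq> {}" "H3 \<noteq> {}"
    and cc: "\<And>X. X \<in> H1 \<union> H2 \<union> H3 \<Longrightarrow> closed X \<and> convex X"
    and tri: "\<And>X Y Z. X \<in> H1 \<Longrightarrow> Y \<in> H2 \<Longrightarrow> Z \<in> H3 \<Longrightarrow> X \<inter> Y \<inter> Z \<noteq> {}"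
  shows "\<exists>H\<in>{H1, H2, H3}. \<exists>w. \<forall>X\<in>H. w \<in> X"
proof -
  define f :: "'a set \<times> 'a set \<Rightarrow> real" where "f = (\<lambda>(X, Y). norm (closest_point (X \<inter> Y) 0))"
  define P where "P = H1 \<times> H2 \<union> H1 \<times> H3 \<union> H2 \<times> H3"
  have "finite (f ` P)" "f ` P \<noteq> {}"
    using fin ne by (auto simp: P_def)
  then have "Max (f ` P) \<in> f ` P"
    by (rule Max_in)
  then obtain C D where CD: "(C, D) \<in> P" "f (C, D) = Max (f ` P)"
    by fastforce
  have max: "f q \<le> f (C, D)" if "q \<in> P" for q
    using that CD(2) \<open>finite (f ` P)\<close> by simp
  have f_sym: "f (X, Y) = f (Y, X)" for X Y
    by (simp add: f_def Int_commute)
  have *: "closest_point (C \<inter> D) 0 \<in> Z"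
    if "C \<in> H1 \<union> H2 \<union> H3" "D \<in> H1 \<union> H2 \<union> H3" "Z \<in> H1 \<union> H2 \<union> H3"
      "C \<inter> D \<inter> Z \<noteq> {}" "(C, Z) \<in> P \<or> (Z, C) \<in> P" "(D, Z) \<in> P \<or> (Z, D) \<in> P" for Z
  proof (rule closest_point_mem_third[OF dim])
    have "f (C, Z) \<le> f (C, D)" "f (D, Z) \<le> f (C, D)"
      using that max f_sym by metis+
    then show "norm (closest_point (C \<inter> Z) 0) \<le> norm (closest_point (C \<inter> D) 0)"
      "norm (closest_point (D \<inter> Z) 0) \<le> norm (closest_point (C \<inter> D) 0)"
      by (auto simp: f_def)
  qed (use that cc in auto)
  consider "C \<in> H1" "D \<in> H2" | "C \<in> H1" "D \<in> H3" | "C \<in> H2" "D \<in> H3"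
    using CD(1) by (auto simp: P_def)
  then show ?thesis
  proof cases
    case 1
    have "closest_point (C \<inter> D) 0 \<in> Z" if "Z \<in> H3" for Z
      using *[of Z] tri[of C D Z] 1 that by (auto simp: P_def)
    then show ?thesis by blast
  next
    case 2
    have "closest_point (C \<inter> D) 0 \<in> Z" if "Z \<in> H2" for Z
      using *[of Z] tri[of C Z D] 2 that by (auto simp: P_def Int_ac)
    then show ?thesis by blast
  next
    case 3
    have "closest_point (C \<inter> D) 0 \<in> Z" if "Z \<in> H1" for Z
      using *[of Z] tri[of Z C D] 3 that by (auto simp: P_def Int_ac)
    then show ?thesis by blast
  qed
qed

section \<open>Greedy sweep along the line\<close>

text \<open>Each round spends one point on the members ending before a stopping place
  \<open>y\<close> and one point at \<open>y\<close>; a last point pierces what is left. If this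
  fails, the rounds exhibit \<open>n + 1\<close> successive groups without a common point.\<close>

lemma greedy_interval_piercing:
  fixes V :: "'a set set" and lo hi :: "'a set \<Rightarrow> real" and pt :: "real \<Rightarrow> 'a"
  assumes "finite V" and "\<And>X. X \<in> V \<Longrightarrow> lo X \<le> hi X"
    and "\<And>X y. X \<in> V \<Longrightarrow> lo X \<le> y \<Longrightarrow> y \<le> hi X \<Longrightarrow> pt y \<in> X"
  shows "(\<exists>T. finite T \<and> card T \<le> 2 * n + 1 \<and> is_transversal T V) \<or>
    (\<exists>H. (\<forall>i\<le>n. H i \<subseteq> V \<and> \<not> (\<exists>w. \<forall>X\<in>H i. w \<in> X)) \<and>
      (\<forall>i j. i < j \<and> j \<le> n \<longrightarrow> (\<forall>X\<in>H i. \<forall>Y\<in>H j. hi X < lo Y)))"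
  using assms
proof (induction n arbitrary: V)
  case 0
  show ?case
  proof (cases "\<exists>w. \<forall>X\<in>V. w \<in> X")
    case True
    then obtain w where "\<forall>X\<in>V. w \<in> X" by blast
    then have "is_transversal {w} V"
      by (auto simp: is_transversal_def)
    then show ?thesis
      by (intro disjI1 exI[of _ "{w}"]) auto
  next
    case False
    then show ?thesis
      by (intro disjI2 exI[of _ "\<lambda>_. V"]) auto
  qed
next
  case (Suc n)
  let ?below = "\<lambda>y. {X \<in> V. hi X \<le> y}"
  \<comment> \<open>The least element \<open>y\<close> is where the sweep stops: members ending by
    \<open>y\<close> have no common point, those ending strictly earlier have one.\<close>
  define Y where "Y = {y \<in> hi ` V. \<not> (\<exists>w. \<forall>X\<in>?below y. w \<in> X)}"
  have "finite Y"
    using Suc.prems(1) by (simp add: Y_def)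
  show ?case
  proof (cases "\<exists>w. \<forall>X\<in>V. w \<in> X")
    case True
    then obtain w where "\<forall>X\<in>V. w \<in> X" by blast
    then have "is_transversal {w} V"
      by (auto simp: is_transversal_def)
    then show ?thesis
      by (intro disjI1 exI[of _ "{w}"]) auto
  next
    case False
    then have "V \<noteq> {}" by blast
    have "?below (Max (hi ` V)) = V"
      using Suc.prems(1) by auto
    then have "\<not> (\<exists>w. \<forall>X\<in>?below (Max (hi ` V)). w \<in> X)"
      using False by metis
    moreover have "Max (hi ` V) \<in> hi ` V"
      using Suc.prems(1) \<open>V \<noteq> {}\<close> by simp
    ultimately have "Max (hi ` V) \<in> Y"
      unfolding Y_def by blast
    define y where "y = Min Y"
    have "y \<in> Y"
      using \<open>finite Y\<close> \<open>Max (hi ` V) \<in> Y\<close> Min_in unfolding y_def by blast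
    have y_min: "y \<le> z" if "z \<in> Y" for z
      using that \<open>finite Y\<close> by (simp add: y_def)
    have "\<exists>w. \<forall>X\<in>{X \<in> V. hi X < y}. w \<in> X"
    proof (cases "{X \<in> V. hi X < y} = {}")
      case False
      define z where "z = Max (hi ` {X \<in> V. hi X < y})"
      have "z \<in> hi ` {X \<in> V. hi X < y}"
        unfolding z_def using Suc.prems(1) False by (intro Max_in) auto
      then have "z < y" "z \<in> hi ` V"
        by auto
      then have "\<exists>w. \<forall>X\<in>?below z. w \<in> X"
        using y_min[of z] unfolding Y_def by force
      moreover have "{X \<in> V. hi X < y} \<subseteq> ?below z"
        using Suc.prems(1) by (auto simp: z_def)
      ultimately show ?thesis by blast
    qed blast
    then obtain w where w: "\<And>X. X \<in> V \<Longrightarrow> hi X < y \<Longrightarrow> w \<in> X"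
      by blast
    let ?W = "{X \<in> V. y < lo X}"
    have "finite ?W" using Suc.prems(1) by simp
    then have "(\<exists>T. finite T \<and> card T \<le> 2 * n + 1 \<and> is_transversal T ?W) \<or>
      (\<exists>H. (\<forall>i\<le>n. H i \<subseteq> ?W \<and> \<not> (\<exists>w. \<forall>X\<in>H i. w \<in> X)) \<and>
        (\<forall>i j. i < j \<and> j \<le> n \<longrightarrow> (\<forall>X\<in>H i. \<forall>Y\<in>H j. hi X < lo Y)))"
    proof (rule Suc.IH)
      show "lo X \<le> hi X" if "X \<in> ?W" for X
        using that Suc.prems(2) by simp
      show "pt z \<in> X" if "X \<in> ?W" "lo X \<le> z" "z \<le> hi X" for X z
        using that Suc.prems(3) by simp
    qed
    then show ?thesis
    proof (elim disjE exE conjE)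
      fix T assume T: "finite T" "card T \<le> 2 * n + 1" "is_transversal T ?W"
      have "is_transversal (insert w (insert (pt y) T)) V"
        unfolding is_transversal_def
      proof
        fix X assume X: "X \<in> V"
        consider "hi X < y" | "y < lo X" | "lo X \<le> y" "y \<le> hi X"
          by linarith
        then show "insert w (insert (pt y) T) \<inter> X \<noteq> {}"
        proof cases
          case 1
          then show ?thesis using w[OF X] by blast
        next
          case 2
          then have "T \<inter> X \<noteq> {}"
            using T(3) X unfolding is_transversal_def by simp
          then show ?thesis by blast
        next
          case 3
          then show ?thesis using Suc.prems(3)[OF X, of y] by blast
        qed
      qed
      moreover have "card (insert w (insert (pt y) T)) \<le> 2 * Suc n + 1"
        using T by (simp add: card_insert_if)
      ultimately show ?thesis
        using T(1) by (intro disjI1 exI[of _ "insert w (insert (pt y) T)"] conjI) simp_all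
    next
      fix H assume H: "\<forall>i\<le>n. H i \<subseteq> ?W \<and> \<not> (\<exists>w. \<forall>X\<in>H i. w \<in> X)"
        "\<forall>i j. i < j \<and> j \<le> n \<longrightarrow> (\<forall>X\<in>H i. \<forall>Y\<in>H j. hi X < lo Y)"
      \<comment> \<open>The group that stopped the sweep comes first; the others start strictly to
        the right of \<open>y\<close>.\<close>
      define H' where "H' i = (case i of 0 \<Rightarrow> ?below y | Suc k \<Rightarrow> H k)" for i
      have "\<forall>i\<le>Suc n. H' i \<subseteq> V \<and> \<not> (\<exists>w. \<forall>X\<in>H' i. w \<in> X)"
      proof (intro allI impI)
        fix i assume "i \<le> Suc n"
        show "H' i \<subseteq> V \<and> \<not> (\<exists>w. \<forall>X\<in>H' i. w \<in> X)"
        proof (cases i)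
          case 0
          then have "H' i = ?below y" by (simp add: H'_def)
          then show ?thesis
            using \<open>y \<in> Y\<close> unfolding Y_def by blast
        next
          case (Suc k)
          then have "H' i = H k" "k \<le> n"
            using \<open>i \<le> Suc n\<close> by (simp_all add: H'_def)
          then show ?thesis
            using H(1) by blast
        qed
      qed
      moreover have "hi X < lo Z" if ij: "i < j" "j \<le> Suc n" and X: "X \<in> H' i" and Z: "Z \<in> H' j" for i j X Z
      proof -
        obtain k where k: "j = Suc k" "k \<le> n"
          using ij by (cases j) auto
        then have Zk: "Z \<in> H k"
          using Z by (simp add: H'_def)
        show ?thesis
        proof (cases i)
          case 0
          then have "hi X \<le> y" using X by (simp add: H'_def)
          moreover have "y < lo Z" using H(1) k Zk by blast
          ultimately show ?thesis by linarith
        next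
          case (Suc l)
          then show ?thesis
            using H(2)[rule_format, of l k] ij k X Zk by (simp add: H'_def)
        qed
      qed
      then have "\<forall>i j. i < j \<and> j \<le> Suc n \<longrightarrow> (\<forall>X\<in>H' i. \<forall>Z\<in>H' j. hi X < lo Z)"
        by blast
      ultimately show ?thesis
        by (intro disjI2 exI[of _ H'] conjI)
    qed
  qed
qed

text \<open>The sweep with \<open>n = 2\<close>: its three bad groups would contradict colourful
  Helly.\<close>

lemma five_point_piercing:
  fixes V :: "'a::euclidean_space set set" and lo hi :: "'a set \<Rightarrow> real" and pt :: "real \<Rightarrow> 'a"
  assumes dim: "DIM('a) = 2" and fin: "finite V"
    and cc: "\<And>X. X \<in> V \<Longrightarrow> closed X \<and> convex X"
    and le: "\<And>X. X \<in> V \<Longrightarrow> lo X \<le> hi X"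
    and pt: "\<And>X y. X \<in> V \<Longrightarrow> lo X \<le> y \<Longrightarrow> y \<le> hi X \<Longrightarrow> pt y \<in> X"
    and tri: "\<And>X Y Z. X \<in> V \<Longrightarrow> Y \<in> V \<Longrightarrow> Z \<in> V \<Longrightarrow> hi X < lo Y \<Longrightarrow> hi Y < lo Z \<Longrightarrow> X \<inter> Y \<inter> Z \<noteq> {}"
  shows "\<exists>T. finite T \<and> card T \<le> 5 \<and> is_transversal T V"
proof (rule ccontr)
  assume neg: "\<not> ?thesis"
  have "\<not> (\<exists>T. finite T \<and> card T \<le> 2 * 2 + 1 \<and> is_transversal T V)"
    using neg by simp
  then obtain H :: "nat \<Rightarrow> 'a set set" where *: "\<forall>i\<le>2. H i \<subseteq> V \<and> \<not> (\<exists>w. \<forall>X\<in>H i. w \<in> X)"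
    and less: "\<forall>i j. i < j \<and> j \<le> 2 \<longrightarrow> (\<forall>X\<in>H i. \<forall>Y\<in>H j. hi X < lo Y)"
    using greedy_interval_piercing[of V lo hi pt 2, OF fin le pt] by blast
  have H: "H i \<subseteq> V" "\<not> (\<exists>w. \<forall>X\<in>H i. w \<in> X)" if "i \<le> 2" for i
    using * that by blast+
  have "\<exists>H'\<in>{H 0, H 1, H 2}. \<exists>w. \<forall>X\<in>H'. w \<in> X"
  proof (rule colourful_helly_plane[OF dim])
    show "X \<inter> Y \<inter> Z \<noteq> {}" if "X \<in> H 0" "Y \<in> H 1" "Z \<in> H 2" for X Y Z
    proof (rule tri)
      show "X \<in> V" "Y \<in> V" "Z \<in> V"
        using H(1)[of 0] H(1)[of 1] H(1)[of 2] that by auto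
      show "hi X < lo Y"
        using less[rule_format, of 0 1 X Y] that by simp
      show "hi Y < lo Z"
        using less[rule_format, of 1 2 Y Z] that by simp
    qed
    show "finite (H 0)" "finite (H 1)" "finite (H 2)"
      using H(1) finite_subset[OF _ fin] by simp_all
    show "H 0 \<noteq> {}" "H 1 \<noteq> {}" "H 2 \<noteq> {}"
      using H(2)[of 0] H(2)[of 1] H(2)[of 2] by auto
    show "closed X \<and> convex X" if "X \<in> H 0 \<union> H 1 \<union> H 2" for X
      using that H(1)[of 0] H(1)[of 1] H(1)[of 2] cc by auto
  qed
  then show False
    using H(2)[of 0] H(2)[of 1] H(2)[of 2] by auto
qed

section \<open>Families with the (4,3)-property\<close>

lemma pq_four_three:
  assumes "pq_property 4 3 \<F>" and "X \<in> \<F>" "Y \<in> \<F>" "Z \<in> \<F>" "W \<in> \<F>"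
    and distinct: "X \<noteq> Y" "X \<noteq> Z" "X \<noteq> W" "Y \<noteq> Z" "Y \<noteq> W" "Z \<noteq> W"
  shows "X \<inter> Y \<inter> Z \<noteq> {} \<or> X \<inter> Y \<inter> W \<noteq> {} \<or> X \<inter> Z \<inter> W \<noteq> {} \<or> Y \<inter> Z \<inter> W \<noteq> {}"
proof -
  have "{X, Y, Z, W} \<subseteq> \<F>" "finite {X, Y, Z, W} \<and> card {X, Y, Z, W} = 4"
    using assms by auto
  then obtain H where H: "H \<subseteq> {X, Y, Z, W}" "card H = 3" "\<Inter>H \<noteq> {}"
    using assms(1)[unfolded pq_property_def, rule_format, of "{X, Y, Z, W}"] by blast
  have "\<not> {X, Y, Z, W} \<subseteq> H"
  proof
    assume "{X, Y, Z, W} \<subseteq> H"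
    then have "H = {X, Y, Z, W}" using H(1) by blast
    then show False using H(2) distinct by simp
  qed
  then have "H \<subseteq> {Y, Z, W} \<or> H \<subseteq> {X, Z, W} \<or> H \<subseteq> {X, Y, W} \<or> H \<subseteq> {X, Y, Z}"
    using H(1) unfolding subset_iff insert_iff empty_iff by metis
  moreover have "P \<inter> Q \<inter> R \<noteq> {}" if "H \<subseteq> {P, Q, R}" "P \<noteq> Q" "P \<noteq> R" "Q \<noteq> R" for P Q R
  proof -
    have "H = {P, Q, R}"
      using that H(2) by (intro card_subset_eq) auto
    then show ?thesis
      using H(3) by (simp add: Int_assoc)
  qed
  ultimately show ?thesis
    using distinct by metis
qed

lemma transversal_of_finite:
  assumes "finite \<F>" and "\<And>F. F \<in> \<F> \<Longrightarrow> F \<noteq> {}"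
  shows "\<exists>T. finite T \<and> card T \<le> card \<F> \<and> is_transversal T \<F>"
proof (intro exI conjI)
  let ?T = "(\<lambda>F. SOME x. x \<in> F) ` \<F>"
  show "finite ?T" "card ?T \<le> card \<F>"
    using assms(1) by (auto intro: card_image_le)
  have "(SOME x. x \<in> F) \<in> F" if "F \<in> \<F>" for F
    using assms(2)[OF that] by (simp add: some_in_eq)
  then show "is_transversal ?T \<F>"
    unfolding is_transversal_def by blast
qed

lemma no_three_disjoint:
  assumes pq: "pq_property 4 3 \<F>" and W: "W \<in> \<F>"
    and XYZ: "X \<in> \<F>" "Y \<in> \<F>" "Z \<in> \<F>" "X \<noteq> Y" "X \<noteq> Z" "Y \<noteq> Z"
    and disj: "X \<inter> Y = {}" "X \<inter> Z = {}" "Y \<inter> Z = {}"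
  shows "W = X \<or> W = Y \<or> W = Z"
proof (rule ccontr)
  assume "\<not> ?thesis"
  then show False
    using pq_four_three[OF pq XYZ(1-3) W] XYZ(4-6) disj by blast
qed

text \<open>Among \<open>B\<close> and three sets missing it, only the triple without
  \<open>B\<close> can meet, so Helly applies.\<close>

lemma avoiding_sets_common_point:
  fixes \<F> :: "'a::euclidean_space set set"
  assumes dim: "DIM('a) = 2" and fin: "finite \<F>" and big: "card \<F> > 3"
    and cv: "\<And>X. X \<in> \<F> \<Longrightarrow> convex X \<and> X \<noteq> {}"
    and pq: "pq_property 4 3 \<F>" and B: "B \<in> \<F>"
  shows "\<exists>w. \<forall>X\<in>{X \<in> \<F>. X \<inter> B = {}}. w \<in> X"
proof -
  let ?H = "{X \<in> \<F>. X \<inter> B = {}}"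
  have B_notin: "X \<noteq> B" if "X \<in> ?H" for X
    using that cv[OF B] by auto
  have finH: "finite ?H"
    using fin by simp
  \<comment> \<open>Disjoint \<open>X\<close> and \<open>Y\<close> would form with \<open>B\<close>
    three pairwise disjoint members, which leaves no room for a fourth.\<close>
  have pair: "X \<inter> Y \<noteq> {}" if "X \<in> ?H" "Y \<in> ?H" for X Y
  proof
    assume disj: "X \<inter> Y = {}"
    then have "X \<noteq> Y"
      using that cv by auto
    have "W = B \<or> W = X \<or> W = Y" if "W \<in> \<F>" for W
      using no_three_disjoint[OF pq that B, of X Y] \<open>X \<in> ?H\<close> \<open>Y \<in> ?H\<close> disj \<open>X \<noteq> Y\<close>
        B_notin[of X] B_notin[of Y] by (auto simp: Int_commute)
    then have "\<F> \<subseteq> {B, X, Y}"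
      by blast
    then have "card \<F> \<le> card {B, X, Y}"
      by (intro card_mono) auto
    also have "\<dots> \<le> 3"
      by (simp add: card_insert_if)
    finally show False
      using big by simp
  qed
  consider "card ?H = 0" | "card ?H = 1" | "card ?H = 2" | "card ?H \<ge> 3"
    by linarith
  then show ?thesis
  proof cases
    case 1
    then have "?H = {}" using finH by simp
    then show ?thesis by blast
  next
    case 2
    then obtain X where "?H = {X}" by (auto simp: card_1_singleton_iff)
    moreover from this have "X \<noteq> {}" using cv by blast
    ultimately show ?thesis by auto
  next
    case 3
    then obtain X Y where "?H = {X, Y}" by (auto simp: card_2_iff)
    moreover from this have "X \<inter> Y \<noteq> {}" using pair[of X Y] by blast
    ultimately show ?thesis by auto
  next
    case 4
    have "\<Inter>?H \<noteq> {}"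
    proof (rule Helly)
      show "DIM('a) + 1 \<le> card ?H"
        using 4 dim by simp
      show "\<forall>s\<in>?H. convex s"
        using cv by simp
      fix t assume t: "t \<subseteq> ?H" "card t = DIM('a) + 1"
      then obtain X Y Z where XYZ: "t = {X, Y, Z}" "X \<noteq> Y" "X \<noteq> Z" "Y \<noteq> Z"
        using dim by (auto simp: card_3_iff)
      then have "X \<in> ?H" "Y \<in> ?H" "Z \<in> ?H"
        using t(1) by auto
      then have "X \<inter> Y \<inter> Z \<noteq> {}"
        using pq_four_three[OF pq B, of X Y Z] XYZ B_notin[of X] B_notin[of Y] B_notin[of Z] by blast
      then show "\<Inter>t \<noteq> {}"
        by (simp add: XYZ Int_assoc)
    qed
    then show ?thesis by blast
  qed
qed

text \<open>The witness is \<open>a\<close> turned by a right angle; it serves as coordinate along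
  the separating line.\<close>

lemma orthogonal_coordinate:
  fixes a :: "real ^ 2"
  assumes "a \<noteq> 0"
  obtains e where "\<And>p q. inner a p = inner a q \<Longrightarrow> inner e p = inner e q \<Longrightarrow> p = q"
proof
  let ?e = "vector [- (a $ 2), a $ 1] :: real ^ 2"
  fix p q assume "inner a p = inner a q" "inner ?e p = inner ?e q"
  then have *: "a $ 1 * (p $ 1 - q $ 1) + a $ 2 * (p $ 2 - q $ 2) = 0"
    "a $ 1 * (p $ 2 - q $ 2) - a $ 2 * (p $ 1 - q $ 1) = 0"
    by (auto simp: inner_vec_def sum_2 algebra_simps)
  have "((a $ 1)\<^sup>2 + (a $ 2)\<^sup>2) * (p $ 1 - q $ 1) = 0" "((a $ 1)\<^sup>2 + (a $ 2)\<^sup>2) * (p $ 2 - q $ 2) = 0"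
    using * by algebra+
  moreover have "(a $ 1)\<^sup>2 + (a $ 2)\<^sup>2 \<noteq> 0"
    using assms by (simp add: sum_power2_eq_zero_iff vec_eq_iff forall_2)
  ultimately show "p = q"
    by (auto simp: vec_eq_iff forall_2)
qed

lemma finite_compact_piercing:
  fixes \<F> :: "(real ^ 2) set set"
  assumes fin: "finite \<F>" and big: "card \<F> > 3"
    and cc: "\<And>X. X \<in> \<F> \<Longrightarrow> compact X \<and> convex X \<and> X \<noteq> {}"
    and pq: "pq_property 4 3 \<F>" and A: "A \<in> \<F>" and B: "B \<in> \<F>" and AB: "A \<inter> B = {}"
  shows "\<exists>T. finite T \<and> card T \<le> 12 \<and> is_transversal T \<F>"
proof -
  have dim: "DIM(real ^ 2) = 2" by simp
  obtain wB where wB: "\<And>X. X \<in> \<F> \<Longrightarrow> X \<inter> B = {} \<Longrightarrow> wB \<in> X"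
    using avoiding_sets_common_point[OF dim fin big _ pq B] cc by blast
  obtain wA where wA: "\<And>X. X \<in> \<F> \<Longrightarrow> X \<inter> A = {} \<Longrightarrow> wA \<in> X"
    using avoiding_sets_common_point[OF dim fin big _ pq A] cc by blast
  obtain a b where sepB: "\<forall>x\<in>B. inner a x < b" and sepA: "\<forall>x\<in>A. inner a x > b"
    using separating_hyperplane_closed_compact[of B A] cc A B AB
    by (auto simp: compact_imp_closed Int_commute)
  have "a \<noteq> 0"
    using sepA sepB cc[OF A] cc[OF B] by fastforce
  then obtain e where e: "\<And>p q. inner a p = inner a q \<Longrightarrow> inner e p = inner e q \<Longrightarrow> p = q"
    using orthogonal_coordinate by blast
  define s where "s = {p. inner a p = b}"
  define V where "V = {X \<in> \<F>. X \<inter> A \<noteq> {} \<and> X \<inter> B \<noteq> {}}"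
  have cut: "S \<inter> s \<noteq> {}" if "convex S" "p \<in> S" "q \<in> S" "inner a p \<le> b" "b \<le> inner a q" for S p q
    using connected_ivt_hyperplane[of S p q a b] that convex_connected by (auto simp: s_def)
  have "\<exists>l h. inner e ` (X \<inter> s) = {l..h} \<and> l \<le> h" if XV: "X \<in> V" for X
  proof -
    obtain p q where "p \<in> X \<inter> A" "q \<in> X \<inter> B"
      using XV unfolding V_def by blast
    moreover from this have "inner a q < b" "b < inner a p"
      using sepA sepB by blast+
    moreover have "convex X"
      using cc XV by (simp add: V_def)
    ultimately have ne: "X \<inter> s \<noteq> {}"
      using cut[of X q p] by simp
    have compact: "compact (X \<inter> s)" and convex: "convex (X \<inter> s)"
      using cc[of X] XV by (auto simp: V_def s_def closed_hyperplane convex_hyperplane intro: compact_Int_closed convex_Int)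
    have cont: "continuous_on (X \<inter> s) (inner e)"
      by (rule linear_continuous_on[OF bounded_linear_inner_right])
    have "connected (inner e ` (X \<inter> s)) \<and> compact (inner e ` (X \<inter> s))"
      using compact_continuous_image[OF cont compact]
        connected_continuous_image[OF cont convex_connected[OF convex]] by simp
    then have "\<exists>l h. inner e ` (X \<inter> s) = {l..h}"
      by (rule connected_compact_interval_1[THEN iffD1])
    then obtain l h where "inner e ` (X \<inter> s) = {l..h}"
      by (elim exE)
    moreover from this ne have "l \<le> h"
      by (metis atLeastatMost_empty_iff image_is_empty)
    ultimately show ?thesis by blast
  qed
  note interval = this
  define lo where "lo X = Inf (inner e ` (X \<inter> s))" for X
  define hi where "hi X = Sup (inner e ` (X \<inter> s))" for X
  have lohi: "inner e ` (X \<inter> s) = {lo X..hi X}" and le: "lo X \<le> hi X" if X: "X \<in> V" for X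
  proof -
    obtain l h where "inner e ` (X \<inter> s) = {l..h}" "l \<le> h"
      using interval[OF X] by blast
    then show "inner e ` (X \<inter> s) = {lo X..hi X}" "lo X \<le> hi X"
      by (simp_all add: lo_def hi_def)
  qed
  define pt where "pt y = (SOME p. p \<in> s \<and> inner e p = y)" for y
  have pt: "pt y \<in> X" if X: "X \<in> V" "lo X \<le> y" "y \<le> hi X" for X y
  proof -
    have "y \<in> inner e ` (X \<inter> s)"
      using lohi X by simp
    then obtain p where p: "p \<in> X" "p \<in> s" "inner e p = y"
      by blast
    then have "pt y \<in> s \<and> inner e (pt y) = y"
      unfolding pt_def by (intro someI[where P = "\<lambda>p. p \<in> s \<and> inner e p = y" and x = p] conjI)
    then have "inner a (pt y) = inner a p" "inner e (pt y) = inner e p"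
      using p unfolding s_def by simp_all
    then have "pt y = p"
      by (rule e)
    then show ?thesis using p(1) by simp
  qed
  define gap where "gap X Y \<longleftrightarrow> hi X < lo Y \<or> hi Y < lo X" for X Y
  \<comment> \<open>Pairs that do not meet receive colour \<open>False\<close>; this is harmless, as
    colours are only compared at common points.\<close>
  define above where "above X Y \<longleftrightarrow> (\<exists>p\<in>X \<inter> Y. b < inner a p)" for X Y
  have gap_neq: "X \<noteq> Y" if "X \<in> V" "gap X Y" for X Y
    using that le[of X] by (auto simp: gap_def)
  \<comment> \<open>The intersection is convex and misses \<open>s\<close>, so it lies entirely on
    one side.\<close>
  have side: "(b < inner a p \<longleftrightarrow> above X Y) \<and> inner a p \<noteq> b"
    if XY: "X \<in> V" "Y \<in> V" "gap X Y" and p: "p \<in> X \<inter> Y" for X Y p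
  proof -
    have disj: "X \<inter> Y \<inter> s = {}"
    proof (rule equals0I)
      fix r assume "r \<in> X \<inter> Y \<inter> s"
      then have "inner e r \<in> {lo X..hi X}" "inner e r \<in> {lo Y..hi Y}"
        using lohi[OF XY(1)] lohi[OF XY(2)] by blast+
      then show False
        using XY(3) by (auto simp: gap_def)
    qed
    have conv: "convex (X \<inter> Y)"
      using XY cc by (auto simp: V_def intro: convex_Int)
    have "inner a p \<noteq> b"
      using disj p by (auto simp: s_def)
    moreover have "b < inner a p" if "above X Y"
    proof (rule ccontr)
      assume "\<not> b < inner a p"
      moreover obtain q where "q \<in> X \<inter> Y" "b < inner a q"
        using \<open>above X Y\<close> by (auto simp: above_def)
      ultimately show False
        using cut[OF conv p, of q] disj by simp
    qed
    moreover have "above X Y" if "b < inner a p"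
      using p that by (auto simp: above_def)
    ultimately show ?thesis by blast
  qed
  have VF: "X \<in> \<F>" "X \<noteq> A" "X \<noteq> B" if "X \<in> V" for X
    using that AB by (auto simp: V_def)
  interpret bicoloured_intervals V lo hi above
  proof
    show "lo X \<le> hi X" if "X \<in> V" for X
      using le that .
    show "above X Y = above Y X" for X Y
      by (auto simp: above_def)
    fix X Y Z W c
    assume V: "X \<in> V" "Y \<in> V" "Z \<in> V" "W \<in> V"
      and gaps: "hi X < lo Y \<or> hi Y < lo X" "hi Y < lo Z \<or> hi Z < lo Y"
        "hi Z < lo W \<or> hi W < lo Z" "hi W < lo X \<or> hi X < lo W"
      and col: "above X Y = c" "above Y Z = (\<not> c)" "above Z W = c" "above W X = (\<not> c)"
    have gaps: "gap X Y" "gap Y Z" "gap Z W" "gap W X"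
      using gaps by (auto simp: gap_def)
    have "above X Y = above Y X" "above Y Z = above Z Y"
      by (auto simp: above_def)
    then have "X \<noteq> Z" "Y \<noteq> W"
      using col by auto
    \<comment> \<open>Any three of the four cyclically ordered sets include two consecutive pairs,
      which have opposite colours; a common point would lie on both sides of
      \<open>s\<close>.\<close>
    then have "X \<inter> Y \<inter> Z \<noteq> {} \<or> X \<inter> Y \<inter> W \<noteq> {} \<or> X \<inter> Z \<inter> W \<noteq> {} \<or> Y \<inter> Z \<inter> W \<noteq> {}"
      using pq_four_three[OF pq VF(1)[OF V(1)] VF(1)[OF V(2)] VF(1)[OF V(3)] VF(1)[OF V(4)]]
        gap_neq[OF V(1) gaps(1)] gap_neq[OF V(2) gaps(2)] gap_neq[OF V(3) gaps(3)] gap_neq[OF V(4) gaps(4)]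
      by blast
    then obtain p where "p \<in> X \<inter> Y \<and> p \<in> Y \<inter> Z \<or> p \<in> X \<inter> Y \<and> p \<in> W \<inter> X
        \<or> p \<in> Z \<inter> W \<and> p \<in> W \<inter> X \<or> p \<in> Y \<inter> Z \<and> p \<in> Z \<inter> W"
      by blast
    then show False
      using side[OF V(1,2) gaps(1), of p] side[OF V(2,3) gaps(2), of p] side[OF V(3,4) gaps(3), of p]
        side[OF V(4,1) gaps(4), of p] col by blast
  qed
  have "finite V"
    using fin by (simp add: V_def)
  then obtain P where P: "P \<subseteq> V" "\<forall>X\<in>P. \<forall>Y\<in>P. hi X < lo Y \<longrightarrow> above X Y"
    "\<forall>X\<in>V - P. \<forall>Y\<in>V - P. hi X < lo Y \<longrightarrow> \<not> above X Y"
    using bicoloured_intervals_split[OF _ bicoloured_intervals_axioms] by blast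
  \<comment> \<open>\<open>D\<close> is the fourth set: by \<open>side_U\<close> no triple
    containing it meets, so the three members of \<open>U\<close> do.\<close>
  have five: "\<exists>T. finite T \<and> card T \<le> 5 \<and> is_transversal T U"
    if U: "U \<subseteq> V" and D: "D \<in> {A, B}"
      and side_U: "\<And>X Y. X \<in> U \<Longrightarrow> Y \<in> U \<Longrightarrow> hi X < lo Y \<Longrightarrow> D \<inter> X \<inter> Y = {}" for U D
  proof (rule five_point_piercing[where V = U and lo = lo and hi = hi and pt = pt])
    show "DIM(real ^ 2) = 2" by (fact dim)
    show "finite U" using U \<open>finite V\<close> finite_subset by blast
    show "closed X \<and> convex X" if "X \<in> U" for X
      using that U cc VF(1) compact_imp_closed by blast
    show "lo X \<le> hi X" if "X \<in> U" for X
      using that U le by blast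
    show "pt y \<in> X" if "X \<in> U" "lo X \<le> y" "y \<le> hi X" for X y
      using that U pt by blast
    fix X Y Z assume XYZ: "X \<in> U" "Y \<in> U" "Z \<in> U" and lt: "hi X < lo Y" "hi Y < lo Z"
    have V: "X \<in> V" "Y \<in> V" "Z \<in> V"
      using XYZ U by auto
    have lt': "hi X < lo Z"
      using lt le[OF V(2)] by linarith
    have neq: "X \<noteq> Y" "Y \<noteq> Z" "X \<noteq> Z"
      using lt lt' le[OF V(1)] le[OF V(2)] by auto
    have "D \<in> \<F>" "D \<noteq> X" "D \<noteq> Y" "D \<noteq> Z"
      using D A B VF(2,3)[OF V(1)] VF(2,3)[OF V(2)] VF(2,3)[OF V(3)] by auto
    then show "X \<inter> Y \<inter> Z \<noteq> {}"
      using pq_four_three[OF pq \<open>D \<in> \<F>\<close> VF(1)[OF V(1)] VF(1)[OF V(2)] VF(1)[OF V(3)]] neq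
        side_U[OF XYZ(1,2) lt(1)] side_U[OF XYZ(1,3) lt'] side_U[OF XYZ(2,3) lt(2)] by blast
  qed
  have "B \<inter> X \<inter> Y = {}" if "X \<in> P" "Y \<in> P" "hi X < lo Y" for X Y
  proof (rule equals0I)
    fix p assume "p \<in> B \<inter> X \<inter> Y"
    then show False
      using side[of X Y p] that P sepB by (force simp: gap_def)
  qed
  then obtain TP where TP: "finite TP" "card TP \<le> 5" "is_transversal TP P"
    using five[of P B] P(1) by blast
  have "A \<inter> X \<inter> Y = {}" if "X \<in> V - P" "Y \<in> V - P" "hi X < lo Y" for X Y
  proof (rule equals0I)
    fix p assume "p \<in> A \<inter> X \<inter> Y"
    then show False
      using side[of X Y p] that P sepA by (force simp: gap_def)
  qed
  then obtain TN where TN: "finite TN" "card TN \<le> 5" "is_transversal TN (V - P)"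
    using five[of "V - P" A] by blast
  let ?T = "{wA, wB} \<union> (TP \<union> TN)"
  have "card ?T \<le> card {wA, wB} + card (TP \<union> TN)"
    by (rule card_Un_le)
  also have "\<dots> \<le> 2 + (card TP + card TN)"
    by (intro add_mono card_Un_le) (simp add: card_insert_if)
  finally have "card ?T \<le> 12"
    using TP TN by simp
  moreover have "is_transversal ?T \<F>"
    unfolding is_transversal_def
  proof
    fix X assume X: "X \<in> \<F>"
    consider "X \<inter> A = {}" | "X \<inter> B = {}" | "X \<in> P" | "X \<in> V - P"
      using X by (auto simp: V_def)
    then show "?T \<inter> X \<noteq> {}"
    proof cases
      case 1 then show ?thesis using wA[OF X] by blast
    next
      case 2 then show ?thesis using wB[OF X] by blast
    next
      case 3 then show ?thesis using TP(3) unfolding is_transversal_def by blast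
    next
      case 4 then show ?thesis using TN(3) unfolding is_transversal_def by blast
    qed
  qed
  ultimately show ?thesis
    using TP TN by (intro exI[of _ ?T]) simp
qed

section \<open>From finite to infinite families by compactness\<close>

text \<open>Transversals are encoded as tuples indexed by \<open>'n\<close>. Tuples from
  \<open>K\<close> form a compact set and those hitting a given member a closed one, so the finite
  intersection property applies.\<close>

lemma compact_piercing:
  fixes \<F> :: "'a::euclidean_space set set"
  assumes K: "compact K" and F: "\<And>X. X \<in> \<F> \<Longrightarrow> closed X \<and> X \<subseteq> K"
    and fin: "\<And>\<G>. finite \<G> \<Longrightarrow> \<G> \<subseteq> \<F> \<Longrightarrow> \<exists>T. finite T \<and> card T \<le> CARD('n::finite) \<and> is_transversal T \<G>"
  shows "\<exists>T. finite T \<and> card T \<le> CARD('n) \<and> is_transversal T \<F>"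
proof (cases "\<F> = {}")
  case True
  then show ?thesis
    by (intro exI[of _ "{}"]) (simp add: is_transversal_def)
next
  case False
  then obtain X0 where X0: "X0 \<in> \<F>" by blast
  define S where "S = {v :: 'a ^ 'n. \<forall>i. v $ i \<in> K}"
  define C where "C X = {v :: 'a ^ 'n. \<exists>i. v $ i \<in> X}" for X
  have comp: "closed {v :: 'a ^ 'n. v $ i \<in> X}" if "closed X" for X i
  proof -
    have "continuous_on UNIV (\<lambda>v :: 'a ^ 'n. v $ i)"
      by (intro continuous_intros)
    then show ?thesis
      using closed_vimage[OF that] by (simp add: vimage_def)
  qed
  have "S = (\<Inter>i. {v. v $ i \<in> K})"
    by (auto simp: S_def)
  then have "closed S"
    using comp[OF compact_imp_closed[OF K]] by auto
  moreover have "bounded S"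
  proof -
    obtain r where r: "\<And>x. x \<in> K \<Longrightarrow> norm x \<le> r"
      using compact_imp_bounded[OF K] by (auto simp: bounded_iff)
    have "norm v \<le> (\<Sum>i\<in>(UNIV :: 'n set). r)" if "v \<in> S" for v
    proof -
      have "norm v \<le> (\<Sum>i\<in>UNIV. norm (v $ i))"
        unfolding norm_vec_def by (rule L2_set_le_sum) simp
      also have "\<dots> \<le> (\<Sum>i\<in>(UNIV :: 'n set). r)"
        using that r by (intro sum_mono) (simp add: S_def)
      finally show ?thesis .
    qed
    then show ?thesis
      unfolding bounded_iff by blast
  qed
  ultimately have "compact S"
    by (simp add: compact_eq_bounded_closed)
  moreover have "closed (C X)" if "X \<in> \<F>" for X
  proof -
    have "C X = (\<Union>i. {v. v $ i \<in> X})"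
      by (auto simp: C_def)
    then show ?thesis
      using comp[of X] F[OF that] by (auto intro: closed_UN)
  qed
  moreover have "S \<inter> \<Inter>(C ` \<G>) \<noteq> {}" if \<G>: "finite \<G>" "\<G> \<subseteq> \<F>" for \<G>
  proof -
    \<comment> \<open>Adjoining \<open>X0\<close> ensures that \<open>T \<inter> K\<close> is
      nonempty even if \<open>\<G>\<close> is empty.\<close>
    obtain T where T: "finite T" "card T \<le> CARD('n)" "is_transversal T (insert X0 \<G>)"
      using fin[of "insert X0 \<G>"] \<G> X0 by auto
    define T' where "T' = T \<inter> K"
    have "finite T'"
      using T(1) by (simp add: T'_def)
    moreover have "card T' \<le> CARD('n)"
      using T(2) card_mono[OF T(1), of T'] by (simp add: T'_def)
    ultimately have "\<exists>g. g ` T' \<subseteq> (UNIV :: 'n set) \<and> inj_on g T'"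
      by (intro card_le_inj finite_class.finite_UNIV)
    then obtain g :: "'a \<Rightarrow> 'n" where g: "inj_on g T'"
      by (elim exE conjE)
    have hit: "\<exists>t. t \<in> T' \<and> t \<in> X" if X: "X \<in> insert X0 \<G>" for X
    proof -
      have "T \<inter> X \<noteq> {}" "X \<subseteq> K"
        using T(3) X F \<G>(2) X0 unfolding is_transversal_def by blast+
      then show ?thesis
        unfolding T'_def by blast
    qed
    then obtain t0 where t0: "t0 \<in> T'"
      by blast
    \<comment> \<open>The points of \<open>T'\<close> are spread over the coordinates by
      \<open>g\<close>; leftover coordinates repeat \<open>t0\<close>.\<close>
    define v where "v = (\<chi> i. if i \<in> g ` T' then inv_into T' g i else t0)"
    have "v $ i \<in> T'" for i
      using t0 by (simp add: v_def inv_into_into)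
    then have "v \<in> S"
      by (simp add: S_def T'_def)
    moreover have "v \<in> C X" if X: "X \<in> \<G>" for X
    proof -
      obtain t where "t \<in> T'" "t \<in> X"
        using hit X by blast
      then have "v $ g t \<in> X"
        using g by (simp add: v_def)
      then show ?thesis
        unfolding C_def by blast
    qed
    ultimately show ?thesis by blast
  qed
  ultimately have "S \<inter> \<Inter>(C ` \<F>) \<noteq> {}"
    by (rule compact_imp_fip_image)
  then obtain v where v: "\<And>X. X \<in> \<F> \<Longrightarrow> v \<in> C X"
    by blast
  have "card (range (($) v)) \<le> CARD('n)"
    by (rule card_image_le) simp
  moreover have "is_transversal (range (($) v)) \<F>"
    using v unfolding is_transversal_def C_def by blast
  ultimately show ?thesis
    by (intro exI[of _ "range (($) v)"]) simp
qed

section \<open>Reduction to traces on a compact convex set\<close>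

theorem theorem2:
  fixes \<F> :: "(real ^ 2) set set" and A B :: "(real ^ 2) set"
  assumes "\<And>F. F \<in> \<F> \<Longrightarrow> closed F \<and> convex F \<and> F \<noteq> {}"
    and "pq_property 4 3 \<F>"
    and "A \<in> \<F>" and "B \<in> \<F>"
    and "compact A" and "compact B" and "A \<inter> B = {}"
  shows "piercing_number \<F> \<le> 13"
proof -
  have "\<exists>T. finite T \<and> card T \<le> 13 \<and> is_transversal T \<F>"
  proof (cases "finite \<F> \<and> card \<F> \<le> 3")
    case True
    then obtain T where "finite T" "card T \<le> card \<F>" "is_transversal T \<F>"
      using transversal_of_finite assms(1) by metis
    then show ?thesis
      using True by (intro exI[of _ T]) simp
  next
    case False
    define K where "K = convex hull (A \<union> B)"
    have "A \<union> B \<subseteq> K"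
      unfolding K_def by (rule hull_subset)
    then have K: "compact K" "convex K" "A \<subseteq> K" "B \<subseteq> K"
      using compact_convex_hull[OF compact_Un[OF assms(5,6)]] convex_convex_hull[of "A \<union> B"]
      unfolding K_def by blast+
    have AB: "A \<noteq> B"
      using assms(1,3,7) by auto
    \<comment> \<open>A meeting triple among \<open>A\<close>, \<open>B\<close>, \<open>X\<close>,
      \<open>Y\<close> cannot contain both \<open>A\<close> and \<open>B\<close>, so
      \<open>X\<close> and \<open>Y\<close> meet inside \<open>A\<close> or inside
      \<open>B\<close>.\<close>
    have meet: "X \<inter> Y \<inter> K \<noteq> {}"
      if "X \<in> \<F>" "Y \<in> \<F>" "X \<noteq> Y" "X \<noteq> A" "X \<noteq> B" "Y \<noteq> A" "Y \<noteq> B" for X Y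
      using pq_four_three[OF assms(2,3,4) that(1,2)] AB that assms(7) K(3,4) by blast
    have ne: "X \<inter> K \<noteq> {}" if X: "X \<in> \<F>" for X
    proof (cases "X = A \<or> X = B")
      case True
      then show ?thesis
        using assms(1,3,4) K(3,4) by blast
    next
      case XAB: False
      have "\<not> \<F> \<subseteq> {A, B, X}"
      proof
        assume "\<F> \<subseteq> {A, B, X}"
        then have "finite \<F>" "card \<F> \<le> card {A, B, X}"
          by (auto intro: finite_subset card_mono)
        moreover have "card {A, B, X} \<le> 3"
          by (simp add: card_insert_if)
        ultimately show False
          using False by simp
      qed
      then obtain Y where "Y \<in> \<F>" "Y \<notin> {A, B, X}"
        by blast
      then show ?thesis
        using meet[OF X, of Y] XAB by blast
    qed
    define \<K> where "\<K> = (\<lambda>X. X \<inter> K) ` \<F>"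
    have K_props: "compact X \<and> convex X \<and> X \<noteq> {} \<and> X \<subseteq> K" if "X \<in> \<K>" for X
      using that assms(1) K(1,2) ne
      by (auto simp: \<K>_def intro: convex_Int closed_Int_compact)
    have mem: "A \<in> \<K>" "B \<in> \<K>"
      using image_eqI[of A "\<lambda>X. X \<inter> K" A \<F>] image_eqI[of B "\<lambda>X. X \<inter> K" B \<F>]
        assms(3,4) K(3,4) unfolding \<K>_def by blast+
    \<comment> \<open>If none of the three lies in \<open>K\<close>, none is \<open>A\<close> or
      \<open>B\<close>; then they meet pairwise in \<open>K\<close> and Helly applies with
      \<open>K\<close> as fourth set.\<close>
    have triple: "X \<inter> Y \<inter> Z \<inter> K \<noteq> {}"
      if XYZ: "X \<in> \<F>" "Y \<in> \<F>" "Z \<in> \<F>" "X \<noteq> Y" "X \<noteq> Z" "Y \<noteq> Z" "X \<inter> Y \<inter> Z \<noteq> {}" for X Y Z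
    proof (cases "X \<subseteq> K \<or> Y \<subseteq> K \<or> Z \<subseteq> K")
      case True
      then show ?thesis
        using XYZ(7) by (elim disjE) auto
    next
      case False
      then have "X \<noteq> A" "X \<noteq> B" "Y \<noteq> A" "Y \<noteq> B" "Z \<noteq> A" "Z \<noteq> B"
        using K(3,4) by metis+
      then have "X \<inter> Y \<inter> K \<noteq> {}" "X \<inter> Z \<inter> K \<noteq> {}" "Y \<inter> Z \<inter> K \<noteq> {}"
        using meet XYZ(1-6) by metis+
      moreover have "convex X" "convex Y" "convex Z"
        using assms(1) XYZ(1-3) by metis+
      ultimately show ?thesis
        using helly_plane_four[OF _ _ _ _ K(2) XYZ(7)] by simp
    qed
    have pq: "pq_property 4 3 \<K>"
      unfolding pq_property_def
    proof (intro allI impI, elim conjE)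
      fix \<G> assume \<G>: "\<G> \<subseteq> \<K>" "finite \<G>" "card \<G> = 4"
      \<comment> \<open>Different members may have the same trace on \<open>K\<close>; choosing one
        preimage per trace keeps the count at four.\<close>
      then obtain \<H> where \<H>: "\<H> \<subseteq> \<F>" "\<G> = (\<lambda>X. X \<inter> K) ` \<H>" "inj_on (\<lambda>X. X \<inter> K) \<H>"
        unfolding \<K>_def by (meson subset_image_inj)
      have "finite \<H>" "card \<H> = 4"
        using \<G>(2,3) card_image[OF \<H>(3)] finite_imageD[OF _ \<H>(3)] by (simp_all add: \<H>(2))
      then obtain \<T> where \<T>: "\<T> \<subseteq> \<H>" "card \<T> = 3" "\<Inter>\<T> \<noteq> {}"
        using assms(2)[unfolded pq_property_def, rule_format, of \<H>] \<H>(1) by blast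
      obtain X Y Z where XYZ: "\<T> = {X, Y, Z}" "X \<noteq> Y" "X \<noteq> Z" "Y \<noteq> Z"
        using \<T>(2) by (auto simp: card_3_iff)
      have "X \<in> \<F>" "Y \<in> \<F>" "Z \<in> \<F>"
        using \<T>(1) \<H>(1) XYZ(1) by blast+
      moreover have "X \<inter> Y \<inter> Z \<noteq> {}"
        using \<T>(3) by (simp add: XYZ(1) Int_assoc)
      ultimately have "X \<inter> Y \<inter> Z \<inter> K \<noteq> {}"
        using triple XYZ(2-4) by metis
      then have "\<Inter>((\<lambda>X. X \<inter> K) ` \<T>) \<noteq> {}"
        by (auto simp: XYZ(1))
      moreover have "card ((\<lambda>X. X \<inter> K) ` \<T>) = 3"
        using \<T> \<H>(3) by (metis card_image inj_on_subset)
      ultimately show "\<exists>\<H>\<subseteq>\<G>. card \<H> = 3 \<and> \<Inter>\<H> \<noteq> {}"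
        using \<T>(1) \<H>(2) by (intro exI[of _ "(\<lambda>X. X \<inter> K) ` \<T>"]) auto
    qed
    have finite_case: "\<exists>T. finite T \<and> card T \<le> CARD(13) \<and> is_transversal T \<G>"
      if \<G>: "finite \<G>" "\<G> \<subseteq> \<K>" for \<G>
    proof -
      \<comment> \<open>\<open>finite_compact_piercing\<close> works with \<open>A\<close> and
        \<open>B\<close> in the family; if at most three sets result, one point each
        suffices.\<close>
      let ?G = "insert A (insert B \<G>)"
      have G: "finite ?G" "?G \<subseteq> \<K>"
        using \<G> mem by auto
      have pqG: "pq_property 4 3 ?G"
        using pq G(2) unfolding pq_property_def by (meson subset_trans)
      have G_props: "compact X \<and> convex X \<and> X \<noteq> {}" if "X \<in> ?G" for X
        using K_props that G(2) by blast
      have "\<exists>T. finite T \<and> card T \<le> 12 \<and> is_transversal T ?G"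
      proof (cases "card ?G > 3")
        case True
        show ?thesis
          by (rule finite_compact_piercing[OF G(1) True G_props pqG _ _ assms(7)]) simp_all
      next
        case False
        have "\<exists>T. finite T \<and> card T \<le> card ?G \<and> is_transversal T ?G"
          by (rule transversal_of_finite[OF G(1)]) (use G_props in blast)
        then obtain T where "finite T" "card T \<le> card ?G" "is_transversal T ?G"
          by (elim exE conjE)
        then show ?thesis
          using False by (intro exI[of _ T]) simp
      qed
      then obtain T where T: "finite T" "card T \<le> 12" "is_transversal T ?G"
        by blast
      moreover have "is_transversal T \<G>"
        using T(3) by (simp add: is_transversal_def)
      ultimately show ?thesis
        by (intro exI[of _ T]) simp
    qed
    have "\<exists>T. finite T \<and> card T \<le> CARD(13) \<and> is_transversal T \<K>"
    proof (rule compact_piercing[OF K(1)])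
      show "closed X \<and> X \<subseteq> K" if "X \<in> \<K>" for X
        using K_props[OF that] compact_imp_closed by blast
    qed (rule finite_case)
    then obtain T where T: "finite T" "card T \<le> 13" "is_transversal T \<K>"
      by auto
    have "T \<inter> X \<noteq> {}" if "X \<in> \<F>" for X
    proof -
      have "X \<inter> K \<in> \<K>"
        using that by (simp add: \<K>_def)
      then have "T \<inter> (X \<inter> K) \<noteq> {}"
        using T(3) unfolding is_transversal_def by blast
      then show ?thesis
        by blast
    qed
    then show ?thesis
      using T(1,2) unfolding is_transversal_def by (intro exI[of _ T]) simp
  qed
  then obtain T where T: "finite T" "card T \<le> 13" "is_transversal T \<F>"
    by blast
  have "piercing_number \<F> \<le> enat (card T)"
    unfolding piercing_number_def using T by (intro INF_lower) simp
  also have "\<dots> \<le> 13"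
    using T(2) by (metis enat_ord_simps(1) numeral_eq_enat)
  finally show ?thesis .
qed

end
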